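(* (i) Let $G$ be a bounded domain in $\mathbb{C}$ such that $\partial G$ contains at least one regular point of convexity. Then $$\frac{\log 3}{\log 2}\le \mathbf{b}(G)<1.7267.$$ (ii) Let $G\ne\mathbb{C}$ be a domain in $\mathbb{C}$ (not necessarily bounded) such that $\partial G$ contains at least one regular point of convexity. Then $$\frac{\log 3}{\log 2}\le \mathbf{b}_a(G)<1.7267.$$
   Context: A domain is a nonempty connected open set. $\Pi=\{s\in\mathbb{C}:\Re s>0\}$ is the right half-plane and $H^\infty(\Pi)$ is the space of bounded holomorphic functions on $\Pi$. For a domain $G\subset\mathbb{C}$, $\widetilde G$ denotes its convex hull. A point $p\in\partial G$ is a point of convexity if $p\in\partial\widetilde G$; a point of convexity $p$ is called regular if there is an open disk $U\subset G$ with $p\in\partial U$. Isometric Bohr abscissa: for a domain $G\subset\mathbb{C}$ with $\widetilde G\ne\mathbb{C}$, $\mathbf{b}(G)$ is the infimum of those real $\sigma\ge 0$ such that for every $f\in H^\infty(\Pi)$ with $f(\Pi)\subset G$ that is represented in $\Pi$ by a convergent ordinary Dirichlet series $f(s)=\sum_{n=1}^\infty a_n n^{-s}$ one has $$\sum_{n=2}^\infty \frac{|a_n|}{n^\sigma}<\operatorname{dist}(a_1,\partial\widetilde G).$$ The quantity $\mathbf{b}_a(G)$ is defined in the same way, except that only those $f$ are considered whose Dirichlet series converges absolutely at every point of $\Pi$. *)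

theory Defs
  imports "HOL-Complex_Analysis.Complex_Analysis"
begin

definition right_half_plane :: "complex set" where
  "right_half_plane = {s. Re s > 0}"

definition H_infinity :: "(complex \<Rightarrow> complex) set" where
  "H_infinity = {f. f holomorphic_on right_half_plane \<and> bounded (f ` right_half_plane)}"

definition is_domain :: "complex set \<Rightarrow> bool" where
  "is_domain G \<longleftrightarrow> G \<noteq> {} \<and> open G \<and> connected G"

definition point_of_convexity :: "complex set \<Rightarrow> complex \<Rightarrow> bool" where
  "point_of_convexity G p \<longleftrightarrow> p \<in> frontier G \<and> p \<in> frontier (convex hull G)"

definition regular_point_of_convexity :: "complex set \<Rightarrow> complex \<Rightarrow> bool" where
  "regular_point_of_convexity G p \<longleftrightarrow> point_of_convexity G p \<and>
     (\<exists>c r. r > 0 \<and> ball c r \<subseteq> G \<and> p \<in> frontier (ball c r))"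

text \<open>Coefficient sequences are functions \<open>a :: nat \<Rightarrow> complex\<close> of which only the values \<open>a n\<close>
  with \<open>n \<ge> 1\<close> matter; the sums over \<open>n \<ge> 1\<close> and \<open>n \<ge> 2\<close> are written as series over all of
  \<open>nat\<close> by shifting the index.\<close>

definition dirichlet_represents :: "(nat \<Rightarrow> complex) \<Rightarrow> (complex \<Rightarrow> complex) \<Rightarrow> bool" where
  "dirichlet_represents a f \<longleftrightarrow>
     (\<forall>s\<in>right_half_plane. (\<lambda>n. a (n + 1) * of_nat (n + 1) powr (- s)) sums f s)"

definition dirichlet_abs_convergent :: "(nat \<Rightarrow> complex) \<Rightarrow> bool" where
  "dirichlet_abs_convergent a \<longleftrightarrow>
     (\<forall>s\<in>right_half_plane. summable (\<lambda>n. norm (a (n + 1) * of_nat (n + 1) powr (- s))))"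

text \<open>A divergent series of nonnegative terms violates the inequality, hence the explicit
  summability conjunct.\<close>

definition bohr_inequality :: "complex set \<Rightarrow> real \<Rightarrow> (nat \<Rightarrow> complex) \<Rightarrow> bool" where
  "bohr_inequality G \<sigma> a \<longleftrightarrow>
     summable (\<lambda>n. norm (a (n + 2)) / real (n + 2) powr \<sigma>) \<and>
     (\<Sum>n. norm (a (n + 2)) / real (n + 2) powr \<sigma>) < infdist (a 1) (frontier (convex hull G))"

text \<open>The infima are taken in the extended reals, so that they are \<open>\<infinity>\<close> if no \<open>\<sigma>\<close> is admissible.
  Both notions are meaningful only if \<open>convex hull G \<noteq> UNIV\<close>, which holds as soon as \<open>G\<close>
  has a point of convexity.\<close>

definition bohr_abscissa :: "complex set \<Rightarrow> ereal" where
  "bohr_abscissa G = Inf {ereal \<sigma> | \<sigma>. \<sigma> \<ge> 0 \<and>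
     (\<forall>f a. f \<in> H_infinity \<longrightarrow> f ` right_half_plane \<subseteq> G \<longrightarrow>
        dirichlet_represents a f \<longrightarrow> bohr_inequality G \<sigma> a)}"

definition bohr_abscissa_abs :: "complex set \<Rightarrow> ereal" where
  "bohr_abscissa_abs G = Inf {ereal \<sigma> | \<sigma>. \<sigma> \<ge> 0 \<and>
     (\<forall>f a. f \<in> H_infinity \<longrightarrow> f ` right_half_plane \<subseteq> G \<longrightarrow>
        dirichlet_represents a f \<longrightarrow> dirichlet_abs_convergent a \<longrightarrow> bohr_inequality G \<sigma> a)}"

end

theory Submission
  imports Defs
begin

text \<open>The upper bound is obtained in the stronger form that the exponent \<open>12/7 = 1.714\<dots>\<close> is admissible.

\<^bold>\<open>Upper bound.\<close> A supporting half-plane at the point of the hull's boundary nearest to \<open>a 1\<close> reduces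
the problem to a bounded \<open>g(s) = \<Sum> b n n\<^sup>-\<^sup>s\<close> with \<open>Re g \<ge> 0\<close> on the right half-plane, for which the
sum of \<open>norm (b n) n\<^sup>-\<^sup>\<sigma>\<close> over \<open>n \<ge> 2\<close> is to be compared with \<open>Re (b 1)\<close>.
Multiply \<open>Re g\<close> by the squared modulus of a generalised Dirichlet polynomial and take the mean
over a vertical line: the result is nonnegative, and it is a quadratic form in which \<open>b (n/m)\<close> occurs
exactly when \<open>m\<close> divides \<open>n\<close> (\<open>nonneg_real_part_imp_divisor_positive_definite\<close>). So all information
about \<open>g\<close> is turned into positivity of finite matrices indexed by divisibility.

If \<open>A\<close> is an antichain for divisibility, testing on \<open>A\<close> together with \<open>1\<close> gives
\<open>\<Sum> (norm (b n))\<^sup>2 \<le> (2 Re (b 1))\<^sup>2\<close> over \<open>A\<close> (\<open>antichain_inequality\<close>). By Cauchy-Schwarz a partition of the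
integers \<open>n \<ge> 2\<close> into antichains \<open>A\<^sub>j\<close> bounds the Bohr sum by \<open>2 Re (b 1)\<close> times the sum of the
\<open>\<ell>\<^sup>2\<close>-norms of \<open>n\<^sup>-\<^sup>\<sigma>\<close> on the \<open>A\<^sub>j\<close>. Grading by the number of prime factors makes this total equal
to \<open>1\<close> just below \<open>1.7267\<close>, with hardly any room for estimates. Room is gained by treating the
primes, which carry most of the sum, with a test on two levels of the divisibility order
(\<open>prime_inequality\<close>): it replaces the \<open>\<ell>\<^sup>2\<close>-norm by something near the maximum norm of the weights.
Then crude antichains suffice for the rest, namely the dyadic intervals from \<open>16\<close> on, and at
\<open>\<sigma> = 12/7\<close> the total is still at most \<open>0.99\<close> (\<open>bohr_sum_bound\<close>).

\<^bold>\<open>Lower bound.\<close> Near a regular point of convexity the domain contains a disk touching the boundary of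
the hull, and a Moebius map of \<open>2\<^sup>-\<^sup>s\<close> onto it behaves as in the classical one-variable Bohr problem,
whose critical radius is \<open>1/3\<close>; thus \<open>2\<^sup>-\<^sup>\<sigma> \<le> 1/3\<close> (\<open>bohr_lower_bound\<close>). The example converges
absolutely, so it serves for both abscissas.\<close>

section \<open>Mean values of a Dirichlet series along vertical lines\<close>

lemma open_right_half_plane: "open right_half_plane"
  unfolding right_half_plane_def by (rule open_halfspace_Re_gt)

lemma convex_right_half_plane: "convex right_half_plane"
  unfolding right_half_plane_def by (rule convex_halfspace_Re_gt)

lemma dirichlet_term_exp:
  "(of_nat (n + 1) :: complex) powr (- s) = exp (- s * of_real (ln (real (n + 1))))"
proof -
  have "Ln (of_nat (n + 1)) = of_real (ln (real (n + 1)))"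
    by (metis Ln_of_real of_nat_0_less_iff of_real_of_nat_eq zero_less_Suc Suc_eq_plus1)
  moreover have "(of_nat (n + 1) :: complex) \<noteq> 0"
    by (metis of_nat_eq_0_iff Suc_eq_plus1 nat.distinct(1))
  ultimately show ?thesis
    by (simp only: powr_def if_False)
qed

text \<open>Convergence at \<open>1/2\<close> forces \<open>b n = O(n powr (1/2))\<close>, so the terms on the line \<open>Re s = 2\<close> are
dominated by a constant times \<open>n powr (-3/2)\<close>, uniformly in \<open>s\<close>.\<close>
lemma dirichlet_tail_small:
  assumes rep: "dirichlet_represents b g" and "e > 0"
  obtains N0 where "\<And>N s. N \<ge> N0 \<Longrightarrow> Re s = 2 \<Longrightarrow>
    norm (g s - (\<Sum>n<N. b (n + 1) * of_nat (n + 1) powr (- s))) \<le> e"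
proof -
  have nrm: "norm ((of_nat (n + 1) :: complex) powr (- s)) = real (n + 1) powr (- Re s)" for n s
    unfolding dirichlet_term_exp norm_exp_eq_Re by (simp add: powr_def)
  have "(\<lambda>n. b (n + 1) * of_nat (n + 1) powr (- (1/2))) sums g (1/2)"
    using rep unfolding dirichlet_represents_def right_half_plane_def by simp
  then have "Bseq (\<lambda>n. b (n + 1) * of_nat (n + 1) powr (- (1/2)))"
    using sums_summable summable_LIMSEQ_zero convergentI convergent_imp_Bseq by blast
  then obtain C where C: "\<And>n. norm (b (n + 1) * of_nat (n + 1) powr (- (1/2))) \<le> C" "C > 0"
    unfolding Bseq_def by blast
  define M where "M = (\<lambda>n::nat. C * real (n + 1) powr (- (3/2)))"
  have bnd: "norm (b (n + 1) * of_nat (n + 1) powr (- s)) \<le> M n" if "Re s = 2" for n s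
  proof -
    have "norm (b (n + 1)) * real (n + 1) powr (- (1/2)) \<le> C"
      using C(1)[of n] nrm[of n "1/2"] by (simp add: norm_mult)
    then have "norm (b (n + 1)) * real (n + 1) powr (- (1/2)) * real (n + 1) powr (- (3/2)) \<le> M n"
      unfolding M_def by (intro mult_right_mono) auto
    moreover have "real (n + 1) powr (- (1/2)) * real (n + 1) powr (- (3/2)) = real (n + 1) powr (- 2)"
      by (simp flip: powr_add)
    ultimately show ?thesis
      unfolding norm_mult nrm that by (simp add: mult.assoc)
  qed
  have "summable (\<lambda>n. real (n + 1) powr (- (3/2)))"
    using summable_real_powr_iff[of "- (3/2)"] summable_iff_shift[of "\<lambda>n. real n powr (- (3/2))" 1]
    by simp
  then have sM: "summable M"
    unfolding M_def by (rule summable_mult)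
  obtain N0 where N0: "\<And>N. N \<ge> N0 \<Longrightarrow> norm (\<Sum>i. M (i + N)) < e"
    using suminf_exist_split[OF \<open>e > 0\<close> sM] by auto
  show ?thesis
  proof (rule that)
    fix N s assume N: "N \<ge> N0" and s: "Re s = (2::real)"
    let ?t = "\<lambda>n. b (n + 1) * of_nat (n + 1) powr (- s)"
    have sums: "?t sums g s"
      using rep s unfolding dirichlet_represents_def right_half_plane_def by simp
    have "(\<lambda>i. ?t (i + N)) sums (g s - (\<Sum>n<N. ?t n))"
      using sums_split_initial_segment[OF sums] .
    then have eq: "g s - (\<Sum>n<N. ?t n) = (\<Sum>i. ?t (i + N))"
      by (rule sums_unique)
    have "norm (\<Sum>i. ?t (i + N)) \<le> (\<Sum>i. M (i + N))"
      by (rule norm_suminf_le) (use bnd[OF s, of "_ + N"] sM summable_iff_shift[of M N] in auto)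
    also have "\<dots> \<le> e"
      using N0[OF N] by simp
    finally show "norm (g s - (\<Sum>n<N. ?t n)) \<le> e"
      unfolding eq .
  qed
qed

text \<open>A primitive of \<open>s \<mapsto> exp (s * l)\<close>. Mean values along vertical lines are computed throughout as
difference quotients of primitives instead of integrals.\<close>
definition exp_primitive :: "real \<Rightarrow> complex \<Rightarrow> complex" where
  "exp_primitive l s = (if l = 0 then s else exp (s * of_real l) / of_real l)"

lemma exp_primitive_deriv:
  "(exp_primitive l has_field_derivative exp (s * of_real l)) (at s)"
proof (cases "l = 0")
  case True
  then have "exp_primitive l = (\<lambda>s. s)" by (simp add: exp_primitive_def fun_eq_iff)
  then show ?thesis using True by (simp)
next
  case False
  then have eq: "exp_primitive l = (\<lambda>s. exp (s * of_real l) / of_real l)"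
    by (simp add: exp_primitive_def fun_eq_iff)
  show ?thesis unfolding eq
    using False by (auto intro!: derivative_eq_intros)
qed

lemma exp_primitive_mean:
  "((\<lambda>T. (exp_primitive l (Complex c T) - exp_primitive l (of_real c)) / (\<i> * of_real T))
     \<longlongrightarrow> (if l = 0 then 1 else 0)) at_top"
proof (cases "l = 0")
  case True
  have "\<forall>\<^sub>F T in at_top. (exp_primitive l (Complex c T) - exp_primitive l (of_real c)) / (\<i> * of_real T) = 1"
    using eventually_gt_at_top[of "0::real"]
    by eventually_elim (simp add: True exp_primitive_def complex_eq_iff Complex_eq)
  then show ?thesis using True by (simp add: tendsto_eventually)
next
  case False
  let ?M = "2 * exp (c * l) / \<bar>l\<bar>"
  have "((\<lambda>T::real. ?M / T) \<longlongrightarrow> 0) at_top"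
    by (rule tendsto_divide_0[OF tendsto_const filterlim_at_top_imp_at_infinity[OF filterlim_ident]])
  moreover have "\<forall>\<^sub>F T in at_top. norm ((exp_primitive l (Complex c T) - exp_primitive l (of_real c))
      / (\<i> * of_real T)) \<le> ?M / T"
    using eventually_gt_at_top[of "0::real"]
  proof eventually_elim
    case (elim T)
    have "norm (exp_primitive l (Complex c T) - exp_primitive l (of_real c))
        \<le> norm (exp_primitive l (Complex c T)) + norm (exp_primitive l (of_real c))"
      by (rule norm_triangle_ineq4)
    also have "\<dots> = ?M"
      using False by (simp add: exp_primitive_def norm_divide)
    finally show ?case
      using elim divide_right_mono[of _ ?M T] by (simp add: norm_divide norm_mult)
  qed
  ultimately have "((\<lambda>T. (exp_primitive l (Complex c T) - exp_primitive l (of_real c))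
      / (\<i> * of_real T)) \<longlongrightarrow> 0) at_top"
    by (rule Lim_null_comparison[rotated])
  then show ?thesis using False by simp
qed

text \<open>The coefficient of the frequency \<open>x\<close>: the sum has at most one term, and is \<open>0\<close> if \<open>x\<close> is not a
positive integer.\<close>
definition coefficient_at :: "(nat \<Rightarrow> complex) \<Rightarrow> real \<Rightarrow> complex" where
  "coefficient_at b x = (\<Sum>n | n \<ge> 1 \<and> real n = x. b n)"

text \<open>On \<open>Re s = 2\<close> the series is uniformly close to a finite Dirichlet polynomial. The polynomial has an
explicit primitive, which grows linearly only through the term \<open>n = x\<close>; a remainder bounded by
\<open>d\<close> changes the difference quotient by at most a multiple of \<open>d\<close>.\<close>
lemma vertical_mean_at_2:
  assumes rep: "dirichlet_represents b g" and "x > 0"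
    and H: "\<And>s. Re s > 0 \<Longrightarrow> (H has_field_derivative g s * exp (s * of_real (ln x))) (at s)"
  shows "((\<lambda>T. (H (Complex 2 T) - H 2) / (\<i> * of_real T)) \<longlongrightarrow> coefficient_at b x) at_top"
proof (rule tendstoI)
  fix e :: real assume "e > 0"
  \<comment> \<open>The factor \<open>x^2\<close> is the modulus of \<open>x\<^sup>s\<close> on the line.\<close>
  define d where "d = e / (2 * x^2)"
  have "d > 0" using \<open>e > 0\<close> \<open>x > 0\<close> by (simp add: d_def)
  obtain N0 where N0: "\<And>N s. N \<ge> N0 \<Longrightarrow> Re s = 2 \<Longrightarrow>
    norm (g s - (\<Sum>n<N. b (n + 1) * of_nat (n + 1) powr (- s))) \<le> d"
    using dirichlet_tail_small[OF rep \<open>d > 0\<close>] by blast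
  define N where "N = max N0 (nat \<lceil>x\<rceil>)"
  define l where "l = (\<lambda>n. ln x - ln (real (n + 1)))"
  define HN where "HN = (\<lambda>s. \<Sum>n<N. b (n + 1) * exp_primitive (l n) s)"
  have l0: "l n = 0 \<longleftrightarrow> real (n + 1) = x" for n
    using \<open>x > 0\<close> ln_inj_iff[of x "real (n + 1)"] unfolding l_def by auto
  have "((\<lambda>T. \<Sum>n<N. b (n + 1) * ((exp_primitive (l n) (Complex 2 T) - exp_primitive (l n) (of_real 2))
      / (\<i> * of_real T))) \<longlongrightarrow> (\<Sum>n<N. b (n + 1) * (if l n = 0 then 1 else 0))) at_top"
    by (intro tendsto_intros exp_primitive_mean)
  moreover have "(\<Sum>n<N. b (n + 1) * (if l n = 0 then 1 else 0)) = coefficient_at b x"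
  proof -
    have "(\<Sum>n<N. b (n + 1) * (if l n = 0 then 1 else 0))
        = (\<Sum>n\<in>{n. n < N \<and> real (n + 1) = x}. b (n + 1))"
      unfolding l0 by (rule sum.mono_neutral_cong_right) auto
    also have "\<dots> = coefficient_at b x"
      unfolding coefficient_at_def
    proof (rule sum.reindex_bij_witness[of _ "\<lambda>n. n - 1" "\<lambda>n. n + 1"])
      fix n assume "n \<in> {n. 1 \<le> n \<and> real n = x}"
      then show "n - 1 \<in> {n. n < N \<and> real (n + 1) = x}"
        by (auto simp: N_def)
    qed auto
    finally show ?thesis .
  qed
  moreover have "(\<Sum>n<N. b (n + 1) * ((exp_primitive (l n) (Complex 2 T) - exp_primitive (l n) (of_real 2))
      / (\<i> * of_real T))) = (HN (Complex 2 T) - HN 2) / (\<i> * of_real T)" for T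
    by (simp add: HN_def diff_divide_distrib sum_divide_distrib right_diff_distrib sum_subtractf)
  ultimately have "((\<lambda>T. (HN (Complex 2 T) - HN 2) / (\<i> * of_real T)) \<longlongrightarrow> coefficient_at b x) at_top"
    by simp
  then have "\<forall>\<^sub>F T in at_top. dist ((HN (Complex 2 T) - HN 2) / (\<i> * of_real T)) (coefficient_at b x) < e / 2"
    by (rule tendstoD) (use \<open>e > 0\<close> in simp)
  then show "\<forall>\<^sub>F T in at_top. dist ((H (Complex 2 T) - H 2) / (\<i> * of_real T)) (coefficient_at b x) < e"
    using eventually_gt_at_top[of "0::real"]
  proof eventually_elim
    case (elim T)
    define S where "S = {s. Re s = 2}"
    have "convex S" 
      using convex_hyperplane[of "1 :: complex" 2] by (simp add: S_def inner_complex_def)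
    let ?R = "\<lambda>s. g s - (\<Sum>n<N. b (n + 1) * of_nat (n + 1) powr (- s))"
    have der: "((\<lambda>s. H s - HN s) has_field_derivative (?R s * exp (s * of_real (ln x)))) (at s within S)"
      if "s \<in> S" for s
    proof -
      have "(HN has_field_derivative (\<Sum>n<N. b (n + 1) * exp (s * of_real (l n)))) (at s)"
        unfolding HN_def by (intro DERIV_sum DERIV_cmult exp_primitive_deriv)
      moreover have "(\<Sum>n<N. b (n + 1) * exp (s * of_real (l n)))
          = (\<Sum>n<N. b (n + 1) * of_nat (n + 1) powr (- s)) * exp (s * of_real (ln x))"
        unfolding sum_distrib_right dirichlet_term_exp l_def
        by (intro sum.cong refl) (simp add: mult.assoc algebra_simps flip: exp_add)
      ultimately have "(HN has_field_derivative (\<Sum>n<N. b (n + 1) * of_nat (n + 1) powr (- s)) * exp (s * of_real (ln x))) (at s)"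
        by simp
      from DERIV_diff[OF H this] show ?thesis
        using that by (simp add: S_def left_diff_distrib has_field_derivative_at_within)
    qed
    have bd: "norm (?R s * exp (s * of_real (ln x))) \<le> e / 2" if "s \<in> S" for s
    proof -
      have "norm (exp (s * of_real (ln x))) = x^2"
        using that \<open>x > 0\<close> exp_of_nat_mult[of 2 "ln x"] by (simp add: S_def)
      moreover have "norm (?R s) \<le> d"
        using that by (intro N0) (auto simp: S_def N_def)
      ultimately have "norm (?R s * exp (s * of_real (ln x))) \<le> d * x^2"
        unfolding norm_mult using \<open>x > 0\<close> by (simp add: mult_right_mono)
      then show ?thesis using \<open>x > 0\<close> by (simp add: d_def)
    qed
    have "norm ((H (Complex 2 T) - HN (Complex 2 T)) - (H 2 - HN 2)) \<le> e / 2 * norm (Complex 2 T - 2)"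
      by (rule field_differentiable_bound[OF \<open>convex S\<close> der bd]) (auto simp: S_def)
    also have "norm (Complex 2 T - 2) = T"
      using elim by (simp add: cmod_def)
    finally have "norm ((H (Complex 2 T) - H 2) - (HN (Complex 2 T) - HN 2)) \<le> e / 2 * T"
      by (simp add: algebra_simps)
    then have "norm (((H (Complex 2 T) - H 2) - (HN (Complex 2 T) - HN 2)) / (\<i> * of_real T)) \<le> e / 2"
      using elim by (simp add: norm_divide norm_mult field_simps)
    then have "dist ((H (Complex 2 T) - H 2) / (\<i> * of_real T)) ((HN (Complex 2 T) - HN 2) / (\<i> * of_real T)) \<le> e / 2"
      by (simp add: dist_norm diff_divide_distrib)
    with elim(1) show ?case
      using dist_triangle[of "(H (Complex 2 T) - H 2) / (\<i> * of_real T)" "coefficient_at b x"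
        "(HN (Complex 2 T) - HN 2) / (\<i> * of_real T)"] by linarith
  qed
qed

text \<open>The line can be moved to any abscissa \<open>c > 0\<close>, although the series need not converge absolutely
there: \<open>H\<close> has bounded derivative on the strip between the two lines, so the increments of \<open>H\<close> along
them differ by \<open>O(1)\<close>, which disappears after division by \<open>T\<close>.\<close>
lemma vertical_mean:
  assumes rep: "dirichlet_represents b g" and bdd: "bounded (g ` right_half_plane)"
    and "x > 0" "c > 0"
    and H: "\<And>s. Re s > 0 \<Longrightarrow> (H has_field_derivative g s * exp (s * of_real (ln x))) (at s)"
  shows "((\<lambda>T. (H (Complex c T) - H (of_real c)) / (\<i> * of_real T)) \<longlongrightarrow> coefficient_at b x) at_top"
proof -
  obtain M where M: "\<And>s. Re s > 0 \<Longrightarrow> norm (g s) \<le> M" "M > 0"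
    using bdd unfolding bounded_pos right_half_plane_def by auto
  define L where "L = M * exp ((c + 2) * \<bar>ln x\<bar>) * \<bar>c - 2\<bar>"
  have shift: "norm (H (Complex c T) - H (Complex 2 T)) \<le> L" for T
  proof -
    define S where "S = {s. 0 < Re s} \<inter> {s. Re s < c + 2 }"
    have "convex S" unfolding S_def
      by (intro convex_Int convex_halfspace_Re_gt convex_halfspace_Re_lt)
    have "norm (H (Complex c T) - H (Complex 2 T))
        \<le> M * exp ((c + 2) * \<bar>ln x\<bar>) * norm (Complex c T - Complex 2 T)"
    proof (rule field_differentiable_bound[OF \<open>convex S\<close>])
      fix s assume s: "s \<in> S"
      then show "(H has_field_derivative g s * exp (s * of_real (ln x))) (at s within S)"
        by (auto simp: S_def intro: has_field_derivative_at_within[OF H])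
      have "Re s * ln x \<le> Re s * \<bar>ln x\<bar>"
        using s by (intro mult_left_mono) (auto simp: S_def)
      also have "\<dots> \<le> (c + 2) * \<bar>ln x\<bar>"
        using s by (intro mult_right_mono) (auto simp: S_def)
      finally show "norm (g s * exp (s * of_real (ln x))) \<le> M * exp ((c + 2) * \<bar>ln x\<bar>)"
        unfolding norm_mult using M s by (intro mult_mono) (auto simp: S_def less_imp_le)
    qed (use \<open>c > 0\<close> in \<open>auto simp: S_def\<close>)
    then show ?thesis by (simp add: L_def cmod_def)
  qed
  have "((\<lambda>T::real. 2 * L / T) \<longlongrightarrow> 0) at_top"
    by (rule tendsto_divide_0[OF tendsto_const filterlim_at_top_imp_at_infinity[OF filterlim_ident]])
  moreover have "\<forall>\<^sub>F T in at_top. norm ((H (Complex c T) - H (of_real c)) / (\<i> * of_real T)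
      - (H (Complex 2 T) - H 2) / (\<i> * of_real T)) \<le> 2 * L / T"
    using eventually_gt_at_top[of "0::real"]
  proof eventually_elim
    case (elim T)
    have c0: "Complex c 0 = of_real c" "Complex 2 0 = 2" by (auto simp: complex_eq_iff)
    have "norm ((H (Complex c T) - H (Complex 2 T)) - (H (of_real c) - H 2)) \<le> 2 * L"
      using norm_triangle_ineq4[of "H (Complex c T) - H (Complex 2 T)" "H (of_real c) - H 2"]
        shift[of T] shift[of 0] unfolding c0 by linarith
    then have "norm ((H (Complex c T) - H (of_real c)) - (H (Complex 2 T) - H 2)) \<le> 2 * L"
      by (simp add: algebra_simps)
    then show ?case
      using elim by (simp add: norm_divide norm_mult divide_right_mono flip: diff_divide_distrib)
  qed
  ultimately have "((\<lambda>T. (H (Complex c T) - H (of_real c)) / (\<i> * of_real T)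
      - (H (Complex 2 T) - H 2) / (\<i> * of_real T)) \<longlongrightarrow> 0) at_top"
    by (rule Lim_null_comparison[rotated])
  from tendsto_add[OF this vertical_mean_at_2[OF rep \<open>x > 0\<close> H]] show ?thesis by simp
qed

section \<open>Positivity along the divisibility order\<close>

lemma coefficient_at_quotient:
  assumes "m \<ge> 1" "n \<ge> 1"
  shows "coefficient_at b (real n / real m) = (if m dvd n then b (n div m) else 0)"
proof (cases "m dvd n")
  case True
  then obtain k where k: "n = m * k" by blast
  have "{j::nat. j \<ge> 1 \<and> real j = real n / real m} = {k}"
    using assms k by auto
  then show ?thesis using True k assms by (simp add: coefficient_at_def)
next
  case False
  have "real j \<noteq> real n / real m" for j
  proof
    assume "real j = real n / real m"
    then have "real (j * m) = real n" using assms by (simp add: field_simps)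
    then have "n = j * m" by linarith
    then show False using False by simp
  qed
  then show ?thesis using False by (simp add: coefficient_at_def)
qed

text \<open>Positive semidefiniteness of the Hermitian matrices with entry \<open>Re (b 1)\<close> on the diagonal,
\<open>b (n div m) / 2\<close> at \<open>(n, m)\<close> if \<open>m\<close> properly divides \<open>n\<close>, the conjugate entry at \<open>(m, n)\<close>, and
zero at incomparable pairs.
The real part does the symmetrisation.\<close>
definition divisor_positive_definite :: "(nat \<Rightarrow> complex) \<Rightarrow> bool" where
  "divisor_positive_definite b \<longleftrightarrow> (\<forall>S c. finite S \<longrightarrow> (\<forall>n\<in>S. n \<ge> 1) \<longrightarrow>
     Re (\<Sum>n\<in>S. \<Sum>m\<in>S. c n * cnj (c m) * (if m dvd n then b (n div m) else 0)) \<ge> 0)"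

text \<open>For fixed \<open>\<kappa> > 0\<close> the quadratic form, with weights \<open>(n/m)\<^sup>-\<^sup>\<kappa>\<close>, is the mean value over the line
\<open>Re s = \<kappa>\<close> of \<open>Re g\<close> times the square of the modulus of \<open>\<Sum> c n n\<^sup>i\<^sup>t\<close>, hence nonnegative. The weights disappear
as \<open>\<kappa>\<close> tends to \<open>0\<close>. Expanding the square gives the frequencies \<open>n/m\<close>, and \<open>g\<close> carries only
integer frequencies, which is why only pairs with \<open>m dvd n\<close> contribute.\<close>
lemma nonneg_real_part_imp_divisor_positive_definite:
  assumes rep: "dirichlet_represents b g" and hol: "g holomorphic_on right_half_plane"
    and bdd: "bounded (g ` right_half_plane)"
    and pos: "\<And>s. Re s > 0 \<Longrightarrow> Re (g s) \<ge> 0"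
  shows "divisor_positive_definite b"
  unfolding divisor_positive_definite_def
proof (intro allI impI)
  fix S :: "nat set" and c :: "nat \<Rightarrow> complex"
  assume "finite S" and "\<forall>n\<in>S. n \<ge> 1"
  then have S: "finite S" "\<And>n. n \<in> S \<Longrightarrow> n \<ge> 1" by auto
  define x where "x = (\<lambda>n m :: nat. real n / real m)"
  have x_pos: "x n m > 0" if "n \<in> S" "m \<in> S" for n m
    using S(2)[OF that(1)] S(2)[OF that(2)] by (simp add: x_def)
  have "\<exists>H. \<forall>s. Re s > 0 \<longrightarrow> (H has_field_derivative g s * exp (s * of_real (ln (x n m)))) (at s)" for n m
  proof -
    have "(\<lambda>s. g s * exp (s * of_real (ln (x n m)))) holomorphic_on right_half_plane"
      by (intro holomorphic_intros hol)
    then obtain H where "\<And>s. s \<in> right_half_plane \<Longrightarrow>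
        (H has_field_derivative g s * exp (s * of_real (ln (x n m)))) (at s within right_half_plane)"
      using holomorphic_convex_primitive'[OF convex_right_half_plane open_right_half_plane] by blast
    then show ?thesis
      using at_within_open[OF _ open_right_half_plane]
      by (metis mem_Collect_eq right_half_plane_def)
  qed
  then obtain H where H: "\<And>n m s. Re s > 0 \<Longrightarrow>
      (H n m has_field_derivative g s * exp (s * of_real (ln (x n m)))) (at s)"
    by metis
  have main: "Re (\<Sum>n\<in>S. \<Sum>m\<in>S. c n * cnj (c m) * of_real (x n m powr (- \<kappa>))
      * coefficient_at b (x n m)) \<ge> 0" if "\<kappa> > 0" for \<kappa>
  proof -
    define w where "w = (\<lambda>n m. c n * cnj (c m) * of_real (x n m powr (- \<kappa>)))"
    define K where "K = (\<lambda>s. \<Sum>n\<in>S. \<Sum>m\<in>S. w n m * H n m s)"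
    define q where "q = (\<lambda>t. \<Sum>n\<in>S. c n * exp (\<i> * of_real (t * ln (real n))))"
    have dK: "(K has_field_derivative g (Complex \<kappa> t) * of_real ((norm (q t))\<^sup>2)) (at (Complex \<kappa> t))" for t
    proof -
      have dK': "(K has_field_derivative (\<Sum>n\<in>S. \<Sum>m\<in>S. w n m * (g (Complex \<kappa> t)
          * exp (Complex \<kappa> t * of_real (ln (x n m)))))) (at (Complex \<kappa> t))"
        unfolding K_def using that by (intro DERIV_sum DERIV_cmult H) simp
      have "w n m * (g (Complex \<kappa> t) * exp (Complex \<kappa> t * of_real (ln (x n m))))
          = g (Complex \<kappa> t) * ((c n * exp (\<i> * of_real (t * ln (real n))))
              * cnj (c m * exp (\<i> * of_real (t * ln (real m)))))"
        if "n \<in> S" "m \<in> S" for n m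
      proof -
        have nm: "real n > 0" "real m > 0" using S(2)[OF that(1)] S(2)[OF that(2)] by auto
        have "of_real (x n m powr (- \<kappa>)) = exp (of_real (- \<kappa> * ln (x n m)) :: complex)"
          using x_pos[OF that] by (simp add: powr_def flip: exp_of_real of_real_mult of_real_minus)
        then have "of_real (x n m powr (- \<kappa>)) * exp (Complex \<kappa> t * of_real (ln (x n m)))
            = exp (of_real (- \<kappa> * ln (x n m)) + Complex \<kappa> t * of_real (ln (x n m)))"
          by (simp only: exp_add)
        also have "of_real (- \<kappa> * ln (x n m)) + Complex \<kappa> t * of_real (ln (x n m))
            = \<i> * of_real (t * ln (real n)) + cnj (\<i> * of_real (t * ln (real m)))"
          using nm by (simp add: x_def ln_div complex_eq_iff algebra_simps)
        also have "exp \<dots> = exp (\<i> * of_real (t * ln (real n))) * cnj (exp (\<i> * of_real (t * ln (real m))))"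
          by (simp only: exp_add exp_cnj)
        finally show ?thesis
          unfolding w_def complex_cnj_mult by (simp add: mult_ac)
      qed
      then have "(\<Sum>n\<in>S. \<Sum>m\<in>S. w n m * (g (Complex \<kappa> t) * exp (Complex \<kappa> t * of_real (ln (x n m)))))
          = (\<Sum>n\<in>S. \<Sum>m\<in>S. g (Complex \<kappa> t) * ((c n * exp (\<i> * of_real (t * ln (real n))))
              * cnj (c m * exp (\<i> * of_real (t * ln (real m))))))"
        by (intro sum.cong refl)
      also have "\<dots> = g (Complex \<kappa> t) * (q t * cnj (q t))"
        unfolding q_def cnj_sum sum_product by (simp only: sum_distrib_left)
      finally show ?thesis
        using dK' unfolding complex_norm_square by simp
    qed
    \<comment> \<open>A primitive in \<open>t\<close> of the nonnegative integrand; hence it is nondecreasing.\<close>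
    define u where "u = (\<lambda>t. Im (K (Complex \<kappa> t)))"
    have du: "(u has_real_derivative Re (g (Complex \<kappa> t)) * (norm (q t))\<^sup>2) (at t)" for t
    proof -
      have "((\<lambda>t. Complex \<kappa> t) has_vector_derivative \<i>) (at t)"
        unfolding Complex_eq by (auto intro!: derivative_eq_intros)
      from field_vector_diff_chain_at[OF this dK[of t]]
      have "((\<lambda>t. K (Complex \<kappa> t)) has_vector_derivative
          (\<i> * (g (Complex \<kappa> t) * of_real ((norm (q t))\<^sup>2)))) (at t)"
        by (simp add: o_def)
      then have "((\<lambda>t. Im (K (Complex \<kappa> t))) has_vector_derivative
          Im (\<i> * (g (Complex \<kappa> t) * of_real ((norm (q t))\<^sup>2)))) (at t)"
        by (rule bounded_linear.has_vector_derivative[OF bounded_linear_Im])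
      then show ?thesis
        by (simp add: u_def has_real_derivative_iff_has_vector_derivative)
    qed
    have mono: "u 0 \<le> u T" if "T \<ge> 0" for T
      by (rule DERIV_nonneg_imp_nondecreasing[OF that])
         (use du pos \<open>\<kappa> > 0\<close> in \<open>auto intro!: exI mult_nonneg_nonneg\<close>)
    have "((\<lambda>T. (K (Complex \<kappa> T) - K (of_real \<kappa>)) / (\<i> * of_real T)) \<longlongrightarrow>
        (\<Sum>n\<in>S. \<Sum>m\<in>S. w n m * coefficient_at b (x n m))) at_top"
    proof -
      have "(K (Complex \<kappa> T) - K (of_real \<kappa>)) / (\<i> * of_real T) = (\<Sum>n\<in>S. \<Sum>m\<in>S. w n m *
          ((H n m (Complex \<kappa> T) - H n m (of_real \<kappa>)) / (\<i> * of_real T)))" for T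
        by (simp add: K_def diff_divide_distrib sum_divide_distrib right_diff_distrib sum_subtractf)
      then show ?thesis
        by (simp only:) (intro tendsto_sum tendsto_mult tendsto_const
          vertical_mean[OF rep bdd _ that H] x_pos)
    qed
    then have "((\<lambda>T. Re ((K (Complex \<kappa> T) - K (of_real \<kappa>)) / (\<i> * of_real T))) \<longlongrightarrow>
        Re (\<Sum>n\<in>S. \<Sum>m\<in>S. w n m * coefficient_at b (x n m))) at_top"
      by (rule tendsto_Re)
    moreover have "\<forall>\<^sub>F T in at_top. 0 \<le> Re ((K (Complex \<kappa> T) - K (of_real \<kappa>)) / (\<i> * of_real T))"
      using eventually_gt_at_top[of "0::real"]
    proof eventually_elim
      case (elim T)
      have "Complex \<kappa> 0 = of_real \<kappa>" by (simp add: complex_eq_iff)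
      then have "Re ((K (Complex \<kappa> T) - K (of_real \<kappa>)) / (\<i> * of_real T)) = (u T - u 0) / T"
        using elim by (simp add: u_def Re_divide power2_eq_square field_simps)
      then show ?case using elim mono[of T] by simp
    qed
    ultimately show ?thesis
      unfolding w_def by (rule tendsto_lowerbound) simp
  qed
  have "((\<lambda>\<kappa>. Re (\<Sum>n\<in>S. \<Sum>m\<in>S. c n * cnj (c m) * of_real (x n m powr (- \<kappa>)) * coefficient_at b (x n m)))
     \<longlongrightarrow> Re (\<Sum>n\<in>S. \<Sum>m\<in>S. c n * cnj (c m) * of_real (x n m powr (- 0)) * coefficient_at b (x n m)))
     (at_right 0)"
    using x_pos by (intro tendsto_intros) (metis less_irrefl)+
  moreover have "\<forall>\<^sub>F \<kappa> in at_right (0::real). 0 \<le> Re (\<Sum>n\<in>S. \<Sum>m\<in>S. c n * cnj (c m)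
      * of_real (x n m powr (- \<kappa>)) * coefficient_at b (x n m))"
    using eventually_at_right_less[of "0::real"] by eventually_elim (rule main)
  ultimately have "0 \<le> Re (\<Sum>n\<in>S. \<Sum>m\<in>S. c n * cnj (c m) * of_real (x n m powr (- 0)) * coefficient_at b (x n m))"
    by (rule tendsto_lowerbound) simp
  also have "(\<Sum>n\<in>S. \<Sum>m\<in>S. c n * cnj (c m) * of_real (x n m powr (- 0)) * coefficient_at b (x n m))
      = (\<Sum>n\<in>S. \<Sum>m\<in>S. c n * cnj (c m) * (if m dvd n then b (n div m) else 0))"
  proof (intro sum.cong refl)
    fix n m assume nm: "n \<in> S" "m \<in> S"
    show "c n * cnj (c m) * of_real (x n m powr (- 0)) * coefficient_at b (x n m)
        = c n * cnj (c m) * (if m dvd n then b (n div m) else 0)"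
      using S(2)[OF nm(1)] S(2)[OF nm(2)] coefficient_at_quotient[OF S(2)[OF nm(2)] S(2)[OF nm(1)]]
      by (simp add: x_def)
  qed
  finally show "Re (\<Sum>n\<in>S. \<Sum>m\<in>S. c n * cnj (c m) * (if m dvd n then b (n div m) else 0)) \<ge> 0" .
qed

section \<open>Coefficient inequalities from antichains\<close>

lemma unimodular_phases:
  fixes b :: "nat \<Rightarrow> complex"
  obtains e where "\<And>n. norm (e n) = 1" "\<And>n. e n * b n = of_real (norm (b n))"
proof
  fix n
  let ?e = "\<lambda>n. if b n = 0 then 1 else cnj (sgn (b n))"
  show "norm (?e n) = 1" by (simp add: norm_sgn)
  show "?e n * b n = of_real (norm (b n))"
    using complex_norm_square[of "b n"]
    by (auto simp: sgn_div_norm scaleR_conv_of_real field_simps power2_eq_square)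
qed

text \<open>The quadratic form of \<open>U \<union> V\<close>: distinct members of one level are incomparable, so apart from the
diagonal only the edges from \<open>U\<close> up to \<open>V\<close> survive.\<close>
lemma two_level_inequality:
  assumes pd: "divisor_positive_definite b"
    and fin: "finite U" "finite V" and ge1: "\<And>n. n \<in> U \<union> V \<Longrightarrow> n \<ge> 1"
    and antiU: "\<And>m n. m \<in> U \<Longrightarrow> n \<in> U \<Longrightarrow> m dvd n \<Longrightarrow> m = n"
    and antiV: "\<And>m n. m \<in> V \<Longrightarrow> n \<in> V \<Longrightarrow> m dvd n \<Longrightarrow> m = n"
    and below: "\<And>m n. m \<in> V \<Longrightarrow> n \<in> U \<Longrightarrow> \<not> m dvd n"
  shows "0 \<le> Re (b 1) * (\<Sum>n\<in>U \<union> V. (norm (c n))\<^sup>2)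
      + Re (\<Sum>n\<in>V. \<Sum>m\<in>U. c n * cnj (c m) * (if m dvd n then b (n div m) else 0))"
proof -
  let ?f = "\<lambda>n m. c n * cnj (c m) * (if m dvd n then b (n div m) else 0)"
  have disj: "U \<inter> V = {}" 
  proof (rule ccontr)
    assume "U \<inter> V \<noteq> {}"
    then obtain n where "n \<in> U" "n \<in> V" by auto
    then show False using below[of n n] by simp
  qed
  have diag: "?f n n = of_real ((norm (c n))\<^sup>2) * b 1" if "n \<in> U \<union> V" for n
    using ge1[OF that] unfolding complex_norm_square by simp
  have level: "(\<Sum>n\<in>W. \<Sum>m\<in>W. ?f n m) = (\<Sum>n\<in>W. of_real ((norm (c n))\<^sup>2)) * b 1"
    if W: "W \<subseteq> U \<union> V" "\<And>m n. m \<in> W \<Longrightarrow> n \<in> W \<Longrightarrow> m dvd n \<Longrightarrow> m = n" "finite W" for W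
  proof -
    have "(\<Sum>m\<in>W. ?f n m) = of_real ((norm (c n))\<^sup>2) * b 1" if "n \<in> W" for n
    proof -
      have "(\<Sum>m\<in>W. ?f n m) = (\<Sum>m\<in>{n}. ?f n m)"
        using that W by (intro sum.mono_neutral_right) auto
      then show ?thesis using diag[of n] that W(1) by auto
    qed
    then show ?thesis by (simp add: sum_distrib_right)
  qed
  have "0 \<le> Re (\<Sum>n\<in>U \<union> V. \<Sum>m\<in>U \<union> V. ?f n m)"
    using pd[unfolded divisor_positive_definite_def, rule_format, of "U \<union> V" c] fin ge1 by simp
  also have "(\<Sum>n\<in>U \<union> V. \<Sum>m\<in>U \<union> V. ?f n m) = (\<Sum>n\<in>U. \<Sum>m\<in>U. ?f n m) + (\<Sum>n\<in>U. \<Sum>m\<in>V. ?f n m)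
      + ((\<Sum>n\<in>V. \<Sum>m\<in>U. ?f n m) + (\<Sum>n\<in>V. \<Sum>m\<in>V. ?f n m))"
    by (simp add: sum.union_disjoint[OF fin disj] sum.distrib)
  also have "(\<Sum>n\<in>U. \<Sum>m\<in>V. ?f n m) = 0"
    using below by (intro sum.neutral) auto
  also have "(\<Sum>n\<in>U. \<Sum>m\<in>U. ?f n m) = (\<Sum>n\<in>U. of_real ((norm (c n))\<^sup>2)) * b 1"
    by (rule level) (use antiU fin in auto)
  also have "(\<Sum>n\<in>V. \<Sum>m\<in>V. ?f n m) = (\<Sum>n\<in>V. of_real ((norm (c n))\<^sup>2)) * b 1"
    by (rule level) (use antiV fin in auto)
  finally show ?thesis
    by (simp add: sum.union_disjoint[OF fin disj] algebra_simps flip: of_real_sum)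
qed

text \<open>With \<open>U = {1}\<close> the edges carry the coefficients \<open>b n\<close>, \<open>n \<in> A\<close>, and the phases of \<open>c\<close> can be
chosen to turn them into \<open>- norm (b n)\<close>. Optimising over \<open>\<mu>\<close> and \<open>w\<close> would give that the
\<open>\<ell>\<^sup>2\<close>-norm of \<open>b\<close> on \<open>A\<close> is at most \<open>2 * Re (b 1)\<close>; the linear form avoids square roots.\<close>
lemma antichain_inequality:
  fixes w :: "nat \<Rightarrow> real"
  assumes pd: "divisor_positive_definite b" and "finite A" and ge2: "\<And>n. n \<in> A \<Longrightarrow> n \<ge> 2"
    and anti: "\<And>m n. m \<in> A \<Longrightarrow> n \<in> A \<Longrightarrow> m dvd n \<Longrightarrow> m = n"
    and "\<mu> > 0" and B: "Re (b 1) \<ge> 0" and \<mu>: "(\<Sum>n\<in>A. (w n)\<^sup>2) \<le> \<mu>\<^sup>2"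
  shows "(\<Sum>n\<in>A. w n * norm (b n)) \<le> Re (b 1) * (2 * \<mu>)"
proof -
  obtain e where e: "\<And>n. norm (e n) = 1" "\<And>n. e n * b n = of_real (norm (b n))"
    using unimodular_phases by blast
  define c where "c = (\<lambda>n. if n = 1 then of_real \<mu> else - (of_real (w n) * e n))"
  have one: "1 \<notin> A" "0 \<notin> A" using ge2 by fastforce+
  have c1: "c n = - (of_real (w n) * e n)" if "n \<in> A" for n
    using that one by (auto simp: c_def)
  have "0 \<le> Re (b 1) * (\<Sum>n\<in>{1} \<union> A. (norm (c n))\<^sup>2)
      + Re (\<Sum>n\<in>A. \<Sum>m\<in>{1}. c n * cnj (c m) * (if m dvd n then b (n div m) else 0))"
  proof (rule two_level_inequality[OF pd])
    show "n \<ge> 1" if "n \<in> {1} \<union> A" for n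
      using that ge2[of n] by auto
    show "\<not> m dvd n" if "m \<in> A" "n \<in> {1}" for m n
      using that one by auto
    show "m = n" if "m \<in> A" "n \<in> A" "m dvd n" for m n
      using that by (rule anti)
  qed (use \<open>finite A\<close> in auto)
  also have "(\<Sum>n\<in>{1} \<union> A. (norm (c n))\<^sup>2) = \<mu>\<^sup>2 + (\<Sum>n\<in>A. (w n)\<^sup>2)"
    using \<open>finite A\<close> one c1 e(1) by (simp add: c_def norm_mult)
  also have "(\<Sum>n\<in>A. \<Sum>m\<in>{1}. c n * cnj (c m) * (if m dvd n then b (n div m) else 0))
      = - of_real (\<mu> * (\<Sum>n\<in>A. w n * norm (b n)))"
  proof -
    have "c n * cnj (c 1) * b n = - of_real (\<mu> * (w n * norm (b n)))" if "n \<in> A" for n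
      using e(2)[of n] unfolding c1[OF that] by (simp add: c_def mult_ac)
    then show ?thesis by (simp add: sum_distrib_left sum_negf)
  qed
  finally have "\<mu> * (\<Sum>n\<in>A. w n * norm (b n)) \<le> Re (b 1) * (\<mu>\<^sup>2 + (\<Sum>n\<in>A. (w n)\<^sup>2))"
    by simp
  also have "\<dots> \<le> Re (b 1) * (\<mu>\<^sup>2 + \<mu>\<^sup>2)"
    using B \<mu> by (intro mult_left_mono) auto
  finally have "\<mu> * (\<Sum>n\<in>A. w n * norm (b n)) \<le> \<mu> * (Re (b 1) * (2 * \<mu>))"
    by (simp add: power2_eq_square algebra_simps)
  then show ?thesis using \<open>\<mu> > 0\<close> by simp
qed

text \<open>The primes form an antichain, but the bound in \<open>\<ell>\<^sup>2\<close> is too weak for them: the truth is closer to \<open>\<ell>\<^sup>1\<close>,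
because \<open>b\<close> at different primes behaves like the linear part of a function of independent variables.
The path \<open>4 - 2 - 6 - 3\<close> with edge ratios \<open>2, 3, 2\<close> lies in two levels and yields the sharp
\<open>norm (b 2) + norm (b 3) / 2 \<le> 2 * Re (b 1)\<close>. A further prime \<open>p\<close> is joined through the
edges \<open>2 - 2 p\<close> and \<open>3 - 3 p\<close>.\<close>
lemma prime_inequality:
  fixes \<beta> :: "nat \<Rightarrow> real"
  assumes pd: "divisor_positive_definite b"
  shows "norm (b 2) + norm (b 3) / 2 + (\<Sum>p\<in>{5,7,11,13}. \<beta> p * norm (b p))
    \<le> Re (b 1) * (2 + (\<Sum>p\<in>{5,7,11,13}. (\<beta> p)\<^sup>2))"
proof -
  obtain e where e: "\<And>n. norm (e n) = 1" "\<And>n. e n * b n = of_real (norm (b n))"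
    using unimodular_phases by blast
  \<comment> \<open>Up to sign and weight, \<open>c\<close> is the completely multiplicative function with \<open>c p = e p\<close>; this makes
    the phase along an edge of ratio \<open>p\<close> depend on \<open>p\<close> only.\<close>
  define c where "c = (\<lambda>n::nat.
     if n = 2 then e 2 else if n = 3 then e 3 else if n = 4 then - (e 2 * e 2)
     else if n = 6 then - (e 2 * e 3)
     else if n = 10 then - (\<beta> 5 * e 2 * e 5) else if n = 15 then - (\<beta> 5 * e 3 * e 5)
     else if n = 14 then - (\<beta> 7 * e 2 * e 7) else if n = 21 then - (\<beta> 7 * e 3 * e 7)
     else if n = 22 then - (\<beta> 11 * e 2 * e 11) else if n = 33 then - (\<beta> 11 * e 3 * e 11)
     else if n = 26 then - (\<beta> 13 * e 2 * e 13) else - (\<beta> 13 * e 3 * e 13))"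
  let ?U = "{2, 3} :: nat set" and ?V = "{4, 6, 10, 15, 14, 21, 22, 33, 26, 39} :: nat set"
  have edge: "- (x * e m * e p) * cnj (e m) * b p = - (x * of_real (norm (b p)))" for x m p
  proof -
    have "e m * cnj (e m) = 1"
      using complex_norm_square[of "e m"] by (simp add: e(1))
    moreover have "- (x * e m * e p) * cnj (e m) * b p = - (x * ((e m * cnj (e m)) * (e p * b p)))"
      by (simp add: mult_ac)
    ultimately show ?thesis by (simp only: e(2) mult_1)
  qed
  have edge1: "- (e m * e p) * cnj (e m) * b p = - of_real (norm (b p))" for m p
    using edge[of 1 m p] by (simp only: mult_1)
  have edge1': "- (e p * e m) * cnj (e m) * b p = - of_real (norm (b p))" for m p
    using edge1[of m p] by (simp only: mult.commute[of "e p"])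
  have c_eq: "c 2 = e 2" "c 3 = e 3" "c 4 = - (e 2 * e 2)" "c 6 = - (e 2 * e 3)"
    "c 10 = - (\<beta> 5 * e 2 * e 5)" "c 15 = - (\<beta> 5 * e 3 * e 5)"
    "c 14 = - (\<beta> 7 * e 2 * e 7)" "c 21 = - (\<beta> 7 * e 3 * e 7)"
    "c 22 = - (\<beta> 11 * e 2 * e 11)" "c 33 = - (\<beta> 11 * e 3 * e 11)"
    "c 26 = - (\<beta> 13 * e 2 * e 13)" "c 39 = - (\<beta> 13 * e 3 * e 13)"
    by (simp_all add: c_def)
  have "0 \<le> Re (b 1) * (\<Sum>n\<in>?U \<union> ?V. (norm (c n))\<^sup>2)
      + Re (\<Sum>n\<in>?V. \<Sum>m\<in>?U. c n * cnj (c m) * (if m dvd n then b (n div m) else 0))"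
    by (rule two_level_inequality[OF pd]) auto
  also have "(\<Sum>n\<in>?U \<union> ?V. (norm (c n))\<^sup>2) = 2 * (2 + (\<Sum>p\<in>{5,7,11,13}. (\<beta> p)\<^sup>2))"
    by (simp add: c_eq norm_mult e(1))
  also have "(\<Sum>n\<in>?V. \<Sum>m\<in>?U. c n * cnj (c m) * (if m dvd n then b (n div m) else 0))
    = - of_real (2 * (norm (b 2) + norm (b 3) / 2 + (\<Sum>p\<in>{5,7,11,13}. \<beta> p * norm (b p))))"
  proof -
    let ?t = "\<lambda>n m p. c n * cnj (c m) * b p"
    have "(\<Sum>n\<in>?V. \<Sum>m\<in>?U. c n * cnj (c m) * (if m dvd n then b (n div m) else 0))
      = ?t 4 2 2 + (?t 6 2 3 + ?t 6 3 2) + ?t 10 2 5 + ?t 15 3 5 + ?t 14 2 7 + ?t 21 3 7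
        + ?t 22 2 11 + ?t 33 3 11 + ?t 26 2 13 + ?t 39 3 13"
      by simp
    moreover have "?t 4 2 2 = - of_real (norm (b 2))" "?t 6 2 3 = - of_real (norm (b 3))"
      "?t 6 3 2 = - of_real (norm (b 2))"
      unfolding c_eq by (rule edge1 edge1')+
    moreover have "?t 10 2 5 = - (of_real (\<beta> 5) * of_real (norm (b 5)))" "?t 15 3 5 = - (of_real (\<beta> 5) * of_real (norm (b 5)))"
      "?t 14 2 7 = - (of_real (\<beta> 7) * of_real (norm (b 7)))" "?t 21 3 7 = - (of_real (\<beta> 7) * of_real (norm (b 7)))"
      "?t 22 2 11 = - (of_real (\<beta> 11) * of_real (norm (b 11)))" "?t 33 3 11 = - (of_real (\<beta> 11) * of_real (norm (b 11)))"
      "?t 26 2 13 = - (of_real (\<beta> 13) * of_real (norm (b 13)))" "?t 39 3 13 = - (of_real (\<beta> 13) * of_real (norm (b 13)))"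
      unfolding c_eq by (rule edge)+
    ultimately show ?thesis by (simp add: algebra_simps)
  qed
  finally have nonneg: "0 \<le> Re (b 1) * (2 * (2 + (\<Sum>p\<in>{5,7,11,13}. (\<beta> p)\<^sup>2)))
      + - (2 * (norm (b 2) + norm (b 3) / 2 + (\<Sum>p\<in>{5,7,11,13}. \<beta> p * norm (b p))))"
    by (simp only: uminus_complex.sel Re_complex_of_real)
  have halve: "y \<le> r * x" if "0 \<le> r * (2 * x) + - (2 * y)" for r x y :: real
    using that by simp
  show ?thesis by (rule halve[OF nonneg])
qed

section \<open>The Bohr sum at exponent 12/7\<close>

abbreviation bohr_weight :: "nat \<Rightarrow> real" where
  "bohr_weight n \<equiv> real n powr (- (12/7))"

lemma bohr_weight_le:
  assumes "n \<ge> 1" "W > 0" "1 \<le> W ^ 7 * real n ^ 12"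
  shows "bohr_weight n \<le> W"
proof (rule power_le_imp_le_base)
  have "bohr_weight n ^ Suc 6 = real n powr (- 12)"
    using assms(1) powr_realpow[of "bohr_weight n" "Suc 6"] by (simp add: powr_powr)
  also have "\<dots> = 1 / real n ^ 12"
    using assms(1) by (simp add: powr_minus_divide)
  also have "\<dots> \<le> W ^ 7"
    using assms by (simp add: field_simps)
  finally show "bohr_weight n ^ Suc 6 \<le> W ^ Suc 6" by simp
qed (use assms in simp)

lemma bohr_weight_numerals:
  "bohr_weight 2 \<le> 0.3048" "bohr_weight 3 \<le> 0.1524" "bohr_weight 4 \<le> 0.0929"
  "bohr_weight 5 \<le> 0.0634" "bohr_weight 6 \<le> 0.0464" "bohr_weight 7 \<le> 0.0356"
  "bohr_weight 8 \<le> 0.0284" "bohr_weight 9 \<le> 0.0232" "bohr_weight 10 \<le> 0.0194"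
  "bohr_weight 11 \<le> 0.0165" "bohr_weight 12 \<le> 0.0142" "bohr_weight 13 \<le> 0.0124"
  "bohr_weight 14 \<le> 0.0109" "bohr_weight 15 \<le> 0.0097"
  by (rule bohr_weight_le; simp add: power_divide)+

lemma sum_atLeastLessThan_double:
  fixes f :: "nat \<Rightarrow> 'a :: comm_monoid_add"
  shows "sum f {2 * a..<2 * b} = (\<Sum>n\<in>{a..<b}. f (2 * n) + f (2 * n + 1))"
proof (cases "a \<le> b")
  case True
  then show ?thesis
    by (induction b rule: dec_induct) (simp_all add: sum.atLeastLessThan_Suc add.assoc)
qed simp

text \<open>Passing from one dyadic interval to the next replaces \<open>n\<close> by \<open>2 n\<close> and \<open>2 n + 1\<close>, so the sum of
squares is multiplied by at most \<open>2 * 2 powr (-24/7) < 0.432\<^sup>2\<close>, and only the interval from \<open>8\<close>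
to \<open>15\<close> needs numerical values.\<close>
lemma dyadic_weight_square_sum:
  "(\<Sum>n\<in>{2 ^ (k + 3)..<2 ^ (k + 4)}. (bohr_weight n)\<^sup>2) \<le> (0.0507 * 0.432 ^ k)\<^sup>2"
proof (induction k)
  case 0
  have "(\<Sum>n\<in>{2 ^ (0 + 3)..<2 ^ (0 + 4)}. (bohr_weight n)\<^sup>2)
      = (\<Sum>n\<in>{8,9,10,11,12,13,14,15}. (bohr_weight n)\<^sup>2)"
    by (rule sum.cong) auto
  also have "\<dots> \<le> 0.0284\<^sup>2 + (0.0232\<^sup>2 + (0.0194\<^sup>2 + (0.0165\<^sup>2 + (0.0142\<^sup>2 + (0.0124\<^sup>2
      + (0.0109\<^sup>2 + 0.0097\<^sup>2))))))"
    using bohr_weight_numerals by (simp add: power_mono add_mono)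
  also have "\<dots> \<le> (0.0507 * 0.432 ^ 0)\<^sup>2"
    by (simp add: power2_eq_square)
  finally show ?case .
next
  case (Suc k)
  have "(\<Sum>n\<in>{2 ^ (Suc k + 3)..<2 ^ (Suc k + 4)}. (bohr_weight n)\<^sup>2)
      = (\<Sum>n\<in>{2 ^ (k + 3)..<2 ^ (k + 4)}. (bohr_weight (2 * n))\<^sup>2 + (bohr_weight (2 * n + 1))\<^sup>2)"
    unfolding add_Suc power_Suc by (rule sum_atLeastLessThan_double)
  also have "\<dots> \<le> (\<Sum>n\<in>{2 ^ (k + 3)..<2 ^ (k + 4)}. 0.432\<^sup>2 * (bohr_weight n)\<^sup>2)"
  proof (rule sum_mono)
    fix n :: nat assume "n \<in> {2 ^ (k + 3)..<2 ^ (k + 4)}"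
    then have "n \<ge> 1" by (metis atLeastLessThan_iff le_trans one_le_numeral one_le_power)
    have "(bohr_weight (2 * n + 1))\<^sup>2 \<le> (bohr_weight (2 * n))\<^sup>2"
      using \<open>n \<ge> 1\<close> by (intro power_mono powr_mono2') auto
    moreover have "(bohr_weight (2 * n))\<^sup>2 = (bohr_weight 2)\<^sup>2 * (bohr_weight n)\<^sup>2"
      by (simp add: powr_mult power_mult_distrib)
    moreover have "(bohr_weight 2)\<^sup>2 \<le> 0.0931"
      using power_mono[OF bohr_weight_numerals(1), of 2] by (simp add: power2_eq_square)
    then have "(bohr_weight 2)\<^sup>2 * (bohr_weight n)\<^sup>2 \<le> 0.0931 * (bohr_weight n)\<^sup>2"
      by (rule mult_right_mono) simp
    moreover have "0.0931 * 2 * (bohr_weight n)\<^sup>2 \<le> 0.432\<^sup>2 * (bohr_weight n)\<^sup>2"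
      by (rule mult_right_mono) (auto simp: power2_eq_square)
    ultimately show "(bohr_weight (2 * n))\<^sup>2 + (bohr_weight (2 * n + 1))\<^sup>2 \<le> 0.432\<^sup>2 * (bohr_weight n)\<^sup>2"
      by linarith
  qed
  also have "\<dots> \<le> 0.432\<^sup>2 * (0.0507 * 0.432 ^ k)\<^sup>2"
    unfolding sum_distrib_left[symmetric] by (rule mult_left_mono[OF Suc]) simp
  also have "\<dots> = (0.0507 * 0.432 ^ Suc k)\<^sup>2"
    by (simp only: power_mult_distrib power_Suc mult_ac)
  finally show ?case .
qed

lemma dyadic_interval_antichain:
  fixes m n k :: nat
  assumes "m \<in> {k..<2 * k}" "n \<in> {k..<2 * k}" "m dvd n"
  shows "m = n"
proof -
  obtain j where j: "n = m * j" using \<open>m dvd n\<close> by blast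
  have "j \<noteq> 0" using assms j by (intro notI) auto
  moreover have "\<not> j \<ge> 2"
  proof
    assume "j \<ge> 2"
    then have "m * 2 \<le> n" unfolding j by (rule mult_le_mono2)
    then show False using assms by auto
  qed
  ultimately have "j = 1" by linarith
  then show ?thesis using j by simp
qed

text \<open>The integers from \<open>2\<close> to \<open>15\<close> are split by their number of prime factors. In \<open>prime_inequality\<close>
the weight of \<open>3\<close> is half the weight of \<open>2\<close>, which is enough here because \<open>(3/2) powr (12/7) \<ge> 2\<close>;
the exponent \<open>12/7\<close> satisfies this with little to spare.\<close>
lemma bohr_sum_up_to_15:
  assumes pd: "divisor_positive_definite b" and B: "Re (b 1) \<ge> 0"
  shows "(\<Sum>n\<in>{2..<16}. bohr_weight n * norm (b n)) \<le> Re (b 1) * 0.912"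
proof -
  define W :: "nat \<Rightarrow> real" where "W = (\<lambda>n. if n = 2 then 0.3048 else if n = 3 then 0.1524
    else if n = 4 then 0.0929 else if n = 5 then 0.0634 else if n = 6 then 0.0464
    else if n = 7 then 0.0356 else if n = 8 then 0.0284 else if n = 9 then 0.0232
    else if n = 10 then 0.0194 else if n = 11 then 0.0165 else if n = 12 then 0.0142
    else if n = 13 then 0.0124 else if n = 14 then 0.0109 else 0.0097)"
  define Z where "Z = (\<lambda>n. W n * norm (b n))"
  have split: "{2..<16} = {2,3,5,7,11,13} \<union> ({4,6,9,10,14,15} \<union> {8,12::nat})"
    by (simp add: set_eq_iff) presburger
  have "(\<Sum>n\<in>{2..<16}. bohr_weight n * norm (b n)) \<le> sum Z {2..<16}"
  proof (rule sum_mono)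
    fix n :: nat assume "n \<in> {2..<16}"
    then have "n \<in> {2,3,4,5,6,7,8,9,10,11,12,13,14,15}" by simp presburger
    then have "bohr_weight n \<le> W n"
      using bohr_weight_numerals by (elim insertE) (simp_all add: W_def)
    then show "bohr_weight n * norm (b n) \<le> Z n"
      unfolding Z_def by (rule mult_right_mono) simp
  qed
  also have "sum Z {2..<16} = sum Z {2,3,5,7,11,13} + (sum Z {4,6,9,10,14,15} + sum Z {8,12})"
    unfolding split by (subst sum.union_disjoint; simp)
  also have "sum Z {2,3,5,7,11,13} \<le> Re (b 1) * 0.6285"
  proof -
    let ?b = "\<lambda>p. W p / 0.3048"
    have "sum Z {2,3,5,7,11,13} = 0.3048 * (norm (b 2) + norm (b 3) / 2 + (\<Sum>p\<in>{5,7,11,13}. ?b p * norm (b p)))"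
      by (simp add: Z_def W_def algebra_simps)
    also have "\<dots> \<le> 0.3048 * (Re (b 1) * (2 + (\<Sum>p\<in>{5,7,11,13}. (?b p)\<^sup>2)))"
      by (intro mult_left_mono prime_inequality[OF pd]) simp
    also have "\<dots> = Re (b 1) * (0.3048 * (2 + (\<Sum>p\<in>{5,7,11,13}. (?b p)\<^sup>2)))"
      by (simp only: mult.left_commute)
    also have "\<dots> \<le> Re (b 1) * 0.6285"
      by (rule mult_left_mono[OF _ B]) (simp add: W_def power_divide power2_eq_square)
    finally show ?thesis .
  qed
  also have "sum Z {4,6,9,10,14,15} \<le> Re (b 1) * (2 * 0.1095)"
    unfolding Z_def
    by (rule antichain_inequality[OF pd _ _ _ _ B]) (auto simp: W_def power2_eq_square)
  also have "sum Z {8,12} \<le> Re (b 1) * (2 * 0.032)"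
    unfolding Z_def
    by (rule antichain_inequality[OF pd _ _ _ _ B]) (auto simp: W_def power2_eq_square)
  finally show ?thesis using B by (simp add: algebra_simps)
qed

text \<open>Each dyadic interval from \<open>16\<close> on is an antichain. The term \<open>0.0772 * 0.432 ^ k\<close> dominates the
geometric tail that is still to come, which makes the induction close.\<close>
lemma bohr_sum_dyadic:
  assumes pd: "divisor_positive_definite b" and B: "Re (b 1) \<ge> 0"
  shows "(\<Sum>n\<in>{2..<2 ^ (k + 4)}. bohr_weight n * norm (b n)) \<le> Re (b 1) * (0.99 - 0.0772 * 0.432 ^ k)"
proof (induction k)
  case 0
  show ?case using bohr_sum_up_to_15[OF pd B] B by (simp add: algebra_simps)
next
  case (Suc k)
  have anti: "m = n" if "m \<in> {2 ^ (k + 4)..<2 ^ (Suc k + 4)}" "n \<in> {2 ^ (k + 4)..<2 ^ (Suc k + 4)}"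
    "m dvd n" for m n :: nat
    using that dyadic_interval_antichain[of m "2 ^ (k + 4)" n]
    by (simp only: add_Suc power_Suc)
  have "(\<Sum>n\<in>{2 ^ (k + 4)..<2 ^ (Suc k + 4)}. bohr_weight n * norm (b n))
      \<le> Re (b 1) * (2 * (0.0507 * 0.432 ^ Suc k))"
  proof (rule antichain_inequality[OF pd _ _ anti _ B])
    show "(\<Sum>n\<in>{2 ^ (k + 4)..<2 ^ (Suc k + 4)}. (bohr_weight n)\<^sup>2) \<le> (0.0507 * 0.432 ^ Suc k)\<^sup>2"
    proof -
      have "k + 4 = Suc k + 3" by simp
      then show ?thesis using dyadic_weight_square_sum[of "Suc k"] by (simp only:)
    qed
    fix n :: nat assume "n \<in> {2 ^ (k + 4)..<2 ^ (Suc k + 4)}"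
    moreover have "(2::nat) ^ 1 \<le> 2 ^ (k + 4)" by (rule power_increasing) auto
    ultimately show "n \<ge> 2" by auto
  qed auto
  moreover have "{2..<2 ^ (Suc k + 4)} = {2..<2 ^ (k + 4)} \<union> {2 ^ (k + 4)..<2 ^ (Suc k + 4) :: nat}"
  proof -
    have "(2::nat) ^ 1 \<le> 2 ^ (k + 4)" "(2::nat) ^ (k + 4) \<le> 2 ^ (Suc k + 4)"
      by (rule power_increasing; simp)+
    then show ?thesis by (intro ivl_disj_un_two(3)[symmetric]) simp_all
  qed
  then have "(\<Sum>n\<in>{2..<2 ^ (Suc k + 4)}. bohr_weight n * norm (b n))
      = (\<Sum>n\<in>{2..<2 ^ (k + 4)}. bohr_weight n * norm (b n))
      + (\<Sum>n\<in>{2 ^ (k + 4)..<2 ^ (Suc k + 4)}. bohr_weight n * norm (b n))"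
    by (simp only:) (rule sum.union_disjoint, auto)
  ultimately have "(\<Sum>n\<in>{2..<2 ^ (Suc k + 4)}. bohr_weight n * norm (b n))
      \<le> Re (b 1) * (0.99 - 0.0772 * 0.432 ^ k) + Re (b 1) * (2 * (0.0507 * 0.432 ^ Suc k))"
    using Suc by linarith
  also have "\<dots> = Re (b 1) * (0.99 - 0.0772 * 0.432 ^ k + 2 * (0.0507 * 0.432 ^ Suc k))"
    by (simp only: distrib_left)
  also have "\<dots> \<le> Re (b 1) * (0.99 - 0.0772 * 0.432 ^ Suc k)"
    by (rule mult_left_mono[OF _ B]) (simp)
  finally show ?case .
qed

lemma bohr_sum_bound:
  assumes pd: "divisor_positive_definite b"
  shows "summable (\<lambda>n. norm (b (n + 2)) / real (n + 2) powr (12/7))"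
    and "(\<Sum>n. norm (b (n + 2)) / real (n + 2) powr (12/7)) \<le> 0.99 * Re (b 1)"
    and "Re (b 1) \<ge> 0"
proof -
  have "0 \<le> Re (\<Sum>n\<in>{1}. \<Sum>m\<in>{1}. (1::complex) * cnj 1 * (if m dvd n then b (n div m) else 0))"
    using pd[unfolded divisor_positive_definite_def, rule_format, of "{1}" "\<lambda>_. 1"] by simp
  then show B: "Re (b 1) \<ge> 0" by simp
  let ?f = "\<lambda>n. norm (b (n + 2)) / real (n + 2) powr (12/7)"
  have le: "sum ?f {..<N} \<le> 0.99 * Re (b 1)" for N
  proof -
    have "sum ?f {..<N} = (\<Sum>n\<in>{2..<N + 2}. bohr_weight n * norm (b n))"
      by (rule sum.reindex_bij_witness[of _ "\<lambda>n. n - 2" "\<lambda>n. n + 2"]) (auto simp: powr_minus_divide)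
    also have "\<dots> \<le> (\<Sum>n\<in>{2..<2 ^ (N + 4)}. bohr_weight n * norm (b n))"
    proof (rule sum_mono2)
      have "N + 4 < 2 ^ (N + 4)" by (rule less_exp)
      then show "{2..<N + 2} \<subseteq> {2..<2 ^ (N + 4)}"
        unfolding ivl_subset by linarith
    qed auto
    also have "\<dots> \<le> Re (b 1) * (0.99 - 0.0772 * 0.432 ^ N)"
      by (rule bohr_sum_dyadic[OF pd B])
    also have "\<dots> \<le> Re (b 1) * 0.99"
      by (rule mult_left_mono[OF _ B]) simp
    finally show ?thesis by (simp add: mult.commute)
  qed
  show S: "summable ?f"
  proof (rule bounded_imp_summable)
    show "sum ?f {..N} \<le> 0.99 * Re (b 1)" for N
      unfolding lessThan_Suc_atMost[symmetric] by (rule le)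
  qed simp
  show "suminf ?f \<le> 0.99 * Re (b 1)"
    by (rule suminf_le_const[OF S le])
qed

section \<open>The upper bound for the abscissas\<close>

text \<open>Let \<open>q\<close> be a boundary point of the convex hull nearest to \<open>a 1\<close>, and rotate a supporting half-plane at
\<open>q\<close> to the right half-plane. Then \<open>g = u (q - f)\<close> has nonnegative real part, and the constant term
of its series has real part at most the distance of \<open>a 1\<close> to \<open>q\<close>. The constant \<open>0.99\<close> gives the strict
inequality, unless that real part vanishes; in this case \<open>f\<close> is constant and \<open>a 1\<close> is an interior
point.\<close>
lemma bohr_inequality_12_7:
  assumes "open G" and bdry: "frontier (convex hull G) \<noteq> {}"
    and f: "f \<in> H_infinity" and range: "f ` right_half_plane \<subseteq> G" and rep: "dirichlet_represents a f"
  shows "bohr_inequality G (12/7) a"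
proof -
  let ?C = "convex hull G"
  have "open ?C" using \<open>open G\<close> by (rule open_convex_hull)
  obtain q where q: "q \<in> frontier ?C" and dist: "infdist (a 1) (frontier ?C) = dist (a 1) q"
    using infdist_attains_inf[OF frontier_closed bdry] by blast
  have "q \<notin> ?C"
    using q \<open>open ?C\<close> by (simp add: frontier_def interior_open)
  moreover have "?C \<noteq> {}" using bdry by (auto simp del: convex_hull_eq_empty)
  ultimately have "\<exists>v \<beta>. v \<noteq> 0 \<and> (\<forall>x\<in>?C. inner v x \<le> \<beta>) \<and> (\<forall>x\<in>{q}. \<beta> \<le> inner v x)"
    by (intro separating_hyperplane_sets convex_convex_hull convex_singleton) auto
  then obtain v \<beta> where "v \<noteq> 0" and sep: "\<And>x. x \<in> ?C \<Longrightarrow> inner v x \<le> \<beta>" "\<beta> \<le> inner v q"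
    by blast
  define u where "u = cnj (sgn v)"
  have norm_u: "norm u = 1" using \<open>v \<noteq> 0\<close> by (simp add: u_def norm_sgn)
  have Re_u: "Re (u * z) = inner v z / norm v" for z
    by (simp add: u_def sgn_div_norm inner_complex_def field_simps)
  define g where "g = (\<lambda>s. u * (q - f s))"
  define b where "b = (\<lambda>n. u * ((if n = 1 then q else 0) - a n))"
  have "dirichlet_represents b g"
    unfolding dirichlet_represents_def
  proof
    fix s assume s: "s \<in> right_half_plane"
    have "(\<lambda>n. if n = 0 then q else 0) sums q"
      using sums_single[of 0 "\<lambda>_. q"] by simp
    moreover have "(\<lambda>n. a (n + 1) * of_nat (n + 1) powr (- s)) sums f s"
      using rep s unfolding dirichlet_represents_def by blast
    ultimately have "(\<lambda>n. u * ((if n = 0 then q else 0) - a (n + 1) * of_nat (n + 1) powr (- s))) sums g s"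
      unfolding g_def by (intro sums_mult sums_diff)
    moreover have "u * ((if n = 0 then q else 0) - a (n + 1) * of_nat (n + 1) powr (- s))
        = b (n + 1) * of_nat (n + 1) powr (- s)" for n
      by (simp add: b_def algebra_simps)
    ultimately show "(\<lambda>n. b (n + 1) * of_nat (n + 1) powr (- s)) sums g s"
      by (simp only:)
  qed
  moreover have "g holomorphic_on right_half_plane"
    using f unfolding H_infinity_def g_def by (auto intro!: holomorphic_intros)
  moreover have "bounded (g ` right_half_plane)"
  proof -
    have "bounded ((\<lambda>x. u * (q - x)) ` (f ` right_half_plane))"
    proof -
      obtain M where M: "\<And>x. x \<in> f ` right_half_plane \<Longrightarrow> norm x \<le> M"
        using f unfolding H_infinity_def bounded_iff by blast
      have "norm (u * (q - x)) \<le> norm q + M" if "x \<in> f ` right_half_plane" for x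
        using norm_triangle_ineq4[of q x] M[OF that] by (simp add: norm_mult norm_u)
      then show ?thesis unfolding bounded_iff by blast
    qed
    then show ?thesis by (simp add: image_image g_def)
  qed
  moreover have "Re (g s) \<ge> 0" if "Re s > 0" for s
  proof -
    have "f s \<in> ?C"
      using that range hull_subset[of G convex] by (auto simp: right_half_plane_def)
    then have "inner v (f s) \<le> inner v q" using sep(1)[of "f s"] sep(2) by simp
    then have "0 \<le> inner v (q - f s)" by (simp add: inner_diff_right)
    then show ?thesis unfolding g_def Re_u by (rule divide_nonneg_nonneg) simp
  qed
  ultimately have pd: "divisor_positive_definite b"
    by (intro nonneg_real_part_imp_divisor_positive_definite)
  have nb: "norm (b (n + 2)) = norm (a (n + 2))" for n
    by (simp add: b_def norm_mult norm_u)
  note bound = bohr_sum_bound[OF pd, unfolded nb]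
  have "Re (b 1) \<le> dist (a 1) q"
    using complex_Re_le_cmod[of "b 1"] by (simp add: b_def norm_mult norm_u dist_norm norm_minus_commute)
  moreover have "dist (a 1) q > 0" if "Re (b 1) = 0"
  proof -
    have sum0: "(\<Sum>n. norm (a (n + 2)) / real (n + 2) powr (12/7)) = 0"
      using bound(2) suminf_nonneg[OF bound(1)] that by simp
    have zero: "a (n + 2) = 0" for n
      using suminf_eq_zero_iff[OF bound(1)] sum0 by (simp add: powr_eq_0_iff) 
    have "(\<lambda>n. a (n + 1) * of_nat (n + 1) powr (- 1)) sums f 1"
      using rep unfolding dirichlet_represents_def right_half_plane_def by simp
    moreover have "a (n + 1) * of_nat (n + 1) powr (- 1) = (if n = 0 then a 1 else 0)" for n
      using zero[of "n - 1"] by (cases n) auto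
    ultimately have "(\<lambda>n. if n = 0 then a 1 else 0) sums f 1"
      by (simp only:)
    moreover have "(\<lambda>n. if n = 0 then a 1 else 0) sums a 1"
      using sums_single[of 0 "\<lambda>_. a 1"] by simp
    ultimately have "a 1 = f 1" by (rule sums_unique2[symmetric])
    moreover have "f 1 \<in> f ` right_half_plane"
      by (rule imageI) (simp add: right_half_plane_def)
    ultimately have "a 1 \<in> ?C"
      using range hull_subset[of G convex] by auto
    then show ?thesis using \<open>q \<notin> ?C\<close> by auto
  qed
  ultimately have "0.99 * Re (b 1) < dist (a 1) q"
    using bound(3) by (cases "Re (b 1) = 0") auto
  then show ?thesis
    unfolding bohr_inequality_def dist using bound(1,2) by auto
qed

section \<open>The lower bound for the abscissas\<close>

lemma powers_of_two_sparse:
  fixes F :: "nat \<Rightarrow> 'a :: real_normed_vector"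
  assumes "\<And>n. n \<notin> range (\<lambda>k. 2 ^ k) \<Longrightarrow> F n = 0"
  shows "(\<lambda>n. F (n + 1)) sums S \<longleftrightarrow> (\<lambda>k. F (2 ^ k)) sums S"
    and "(\<lambda>n. F (n + 2)) sums S \<longleftrightarrow> (\<lambda>k. F (2 ^ Suc k)) sums S"
proof -
  have mono: "strict_mono (\<lambda>k. 2 ^ k - 1 :: nat)" "strict_mono (\<lambda>k. 2 ^ Suc k - 2 :: nat)"
    unfolding strict_mono_Suc_iff by (intro allI diff_less_mono; simp)+
  have ge: "(2::nat) ^ k \<ge> 1" "(2::nat) ^ Suc k \<ge> 2" for k by simp_all
  have z1: "F (n + 1) = 0" if "n \<notin> range (\<lambda>k. 2 ^ k - 1)" for n
  proof (rule assms, rule notI)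
    assume "n + 1 \<in> range (\<lambda>k. 2 ^ k)"
    then obtain k where "n + 1 = 2 ^ k" by blast
    then have "n = 2 ^ k - 1" by linarith
    then show False using that by blast
  qed
  have "(\<lambda>k. F (2 ^ k - 1 + 1)) sums S \<longleftrightarrow> (\<lambda>n. F (n + 1)) sums S"
    by (rule sums_mono_reindex[OF mono(1)]) (rule z1)
  then show "(\<lambda>n. F (n + 1)) sums S \<longleftrightarrow> (\<lambda>k. F (2 ^ k)) sums S"
    using ge(1) by (simp only: le_add_diff_inverse2)
  have z2: "F (n + 2) = 0" if "n \<notin> range (\<lambda>k. 2 ^ Suc k - 2)" for n
  proof (rule assms, rule notI)
    assume "n + 2 \<in> range (\<lambda>k. 2 ^ k)"
    then obtain k where k: "n + 2 = 2 ^ k" by blast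
    then obtain j where "k = Suc j" by (cases k) auto
    then have "n = 2 ^ Suc j - 2" using k by (metis diff_add_inverse2)
    then show False using that by blast
  qed
  have "(\<lambda>k. F (2 ^ Suc k - 2 + 2)) sums S \<longleftrightarrow> (\<lambda>n. F (n + 2)) sums S"
    by (rule sums_mono_reindex[OF mono(2)]) (rule z2)
  then show "(\<lambda>n. F (n + 2)) sums S \<longleftrightarrow> (\<lambda>k. F (2 ^ Suc k)) sums S"
    using ge(2) by (simp only: le_add_diff_inverse2)
qed

text \<open>Let \<open>f\<close> be a Moebius map from the unit disk onto a disk touching the boundary at \<open>p\<close>, applied to
\<open>2\<^sup>-\<^sup>s\<close>, with constant term at distance \<open>r (1 - t)\<close> from \<open>p\<close>. Its coefficients at the powers of two are geometric, and with
\<open>y = 2\<^sup>\<sigma>\<close> the Bohr inequality becomes \<open>(1 + t) / (y - t) < 1\<close>, that is \<open>y > 1 + 2 t\<close>. Letting \<open>t\<close>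
tend to \<open>1\<close> forces \<open>y \<ge> 3\<close>.\<close>
lemma bohr_lower_bound:
  assumes p: "regular_point_of_convexity G p" and "\<sigma> \<ge> 0"
    and adm: "\<And>f a. f \<in> H_infinity \<Longrightarrow> f ` right_half_plane \<subseteq> G \<Longrightarrow> dirichlet_represents a f
      \<Longrightarrow> dirichlet_abs_convergent a \<Longrightarrow> bohr_inequality G \<sigma> a"
  shows "ln 3 / ln 2 \<le> \<sigma>"
proof (rule ccontr)
  assume "\<not> ln 3 / ln 2 \<le> \<sigma>"
  then have "\<sigma> * ln 2 < ln 3" by (simp add: field_simps)
  define y where "y = 2 powr \<sigma>"
  have "y < exp (ln 3)"
    unfolding y_def powr_def using \<open>\<sigma> * ln 2 < ln 3\<close> by (simp del: exp_ln)
  then have y: "1 \<le> y" "y < 3"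
    using \<open>\<sigma> \<ge> 0\<close> by (auto simp: y_def ge_one_powr_ge_zero)
  \<comment> \<open>Chosen so that \<open>y \<le> 1 + 2 t\<close>; that \<open>t < 1\<close> is possible is the assumption \<open>y < 3\<close>.\<close>
  define t where "t = (y + 1) / 4"
  have t: "0 < t" "t < 1" "y \<le> 1 + 2 * t" using y by (auto simp: t_def field_simps)
  have norm_t: "norm (1 - (of_real t :: complex)\<^sup>2) = 1 - t\<^sup>2"
  proof -
    have "1 - (of_real t :: complex)\<^sup>2 = of_real (1 - t\<^sup>2)" by simp
    then have "norm (1 - (of_real t :: complex)\<^sup>2) = \<bar>1 - t\<^sup>2\<bar>" by (simp only: norm_of_real)
    then show ?thesis using t power_le_one[of t 2] by simp
  qed
  obtain c r where r: "r > 0" and disc: "ball c r \<subseteq> G" and "p \<in> frontier (ball c r)"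
    and pC: "p \<in> frontier (convex hull G)"
    using p unfolding regular_point_of_convexity_def point_of_convexity_def by blast
  then have pr: "norm (p - c) = r"
    by (simp add: frontier_ball dist_norm norm_minus_commute)
  define \<alpha> where "\<alpha> = (\<lambda>k. if k = 0 then c + (p - c) * t else - ((p - c) * (1 - t\<^sup>2) * t ^ (k - 1)))"
  define a where "a = (\<lambda>n. if n \<in> range (\<lambda>k::nat. (2::nat) ^ k) then \<alpha> (the_inv (\<lambda>k::nat. (2::nat) ^ k) n) else 0)"
  define f where "f = (\<lambda>s. c - (p - c) * Moebius_function 0 (of_real t) (2 powr (- s)))"
  have a_pow: "a (2 ^ k) = \<alpha> k" for k
    unfolding a_def by (simp add: the_inv_f_f inj_on_def)
  have a_zero: "a n = 0" if "n \<notin> range (\<lambda>k. 2 ^ k)" for n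
    using that by (simp add: a_def)
  have z: "norm ((2::complex) powr (- s)) < 1" if "s \<in> right_half_plane" for s
    using that by (simp add: norm_powr_real_powr right_half_plane_def powr_less_one)
  have pow: "(of_nat (2 ^ k) :: complex) powr (- s) = (2 powr (- s)) ^ k" for k s
  proof (induction k)
    case (Suc k)
    have "(of_nat (2 ^ Suc k) :: complex) powr (- s) = (of_real 2 * of_real (2 ^ k)) powr (- s)"
      by simp
    also have "\<dots> = of_real 2 powr (- s) * of_real (2 ^ k) powr (- s)"
      by (rule powr_times_real) auto
    finally show ?case using Suc by simp
  qed simp
  have "f \<in> H_infinity \<and> f ` right_half_plane \<subseteq> G"
  proof -
    have sub: "f ` right_half_plane \<subseteq> ball c r"
    proof
      fix w assume "w \<in> f ` right_half_plane"
      then obtain s where s: "s \<in> right_half_plane" and w: "w = f s" by blast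
      have "norm (Moebius_function 0 (of_real t) (2 powr (- s))) < 1"
        by (rule Moebius_function_norm_lt_1) (use t z[OF s] in auto)
      then show "w \<in> ball c r"
        using r pr by (simp add: w f_def dist_norm norm_mult)
    qed
    have "(\<lambda>s. Moebius_function 0 (of_real t) (2 powr (- s))) holomorphic_on right_half_plane"
    proof -
      have "(Moebius_function 0 (of_real t) \<circ> (\<lambda>s. 2 powr (- s))) holomorphic_on right_half_plane"
        by (rule holomorphic_on_compose_gen[OF _ Moebius_function_holomorphic[of _ 0]])
           (use t z in \<open>auto intro!: holomorphic_intros\<close>)
      then show ?thesis by (simp add: o_def)
    qed
    then have "f holomorphic_on right_half_plane"
      unfolding f_def by (intro holomorphic_intros)
    then show ?thesis
      unfolding H_infinity_def using sub disc bounded_subset[OF bounded_ball sub] by auto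
  qed
  moreover have "dirichlet_represents a f"
    unfolding dirichlet_represents_def
  proof
    fix s assume s: "s \<in> right_half_plane"
    define z where "z = (2::complex) powr (- s)"
    have "norm (of_real t * z) < 1"
      using t z[OF s] mult_strict_mono[of t 1 "norm z" 1] by (simp add: z_def norm_mult)
    then have "(\<lambda>k. (of_real t * z) ^ k) sums (1 / (1 - of_real t * z))"
      by (rule geometric_sums)
    then have "(\<lambda>k. - ((p - c) * (1 - t\<^sup>2) * z) * (of_real t * z) ^ k)
        sums (- ((p - c) * (1 - t\<^sup>2) * z) * (1 / (1 - of_real t * z)))"
      by (rule sums_mult)
    moreover have "- ((p - c) * (1 - t\<^sup>2) * z) * (of_real t * z) ^ k = \<alpha> (Suc k) * z ^ Suc k" for k
      by (simp add: \<alpha>_def power_mult_distrib)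
    ultimately have "(\<lambda>k. \<alpha> (Suc k) * z ^ Suc k) sums (- ((p - c) * (1 - t\<^sup>2) * z) * (1 / (1 - of_real t * z)))"
      by (simp only:)
    then have "(\<lambda>k. \<alpha> k * z ^ k) sums (- ((p - c) * (1 - t\<^sup>2) * z) * (1 / (1 - of_real t * z)) + \<alpha> 0 * z ^ 0)"
      by (rule sums_Suc)
    moreover have "- ((p - c) * (1 - t\<^sup>2) * z) * (1 / (1 - of_real t * z)) + \<alpha> 0 * z ^ 0 = f s"
    proof -
      have "1 - of_real t * z \<noteq> 0" using \<open>norm (of_real t * z) < 1\<close> by force
      then show ?thesis
        by (simp add: f_def Moebius_function_def \<alpha>_def flip: z_def)
           (simp add: divide_simps, simp add: algebra_simps power2_eq_square)
    qed
    ultimately have "(\<lambda>k. a (2 ^ k) * of_nat (2 ^ k) powr (- s)) sums f s"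
      unfolding pow a_pow z_def by (simp only:)
    then show "(\<lambda>n. a (n + 1) * of_nat (n + 1) powr (- s)) sums f s"
      by (subst powers_of_two_sparse(1)[where F = "\<lambda>n. a n * of_nat n powr (- s)"])
         (auto simp: a_zero)
  qed
  moreover have "dirichlet_abs_convergent a"
    unfolding dirichlet_abs_convergent_def
  proof
    fix s assume s: "s \<in> right_half_plane"
    define z where "z = (2::complex) powr (- s)"
    have "norm (t * norm z) < 1"
      using t z[OF s] mult_strict_mono[of t 1 "norm z" 1] by (simp add: z_def)
    then have "summable (\<lambda>k. r * (1 - t\<^sup>2) * norm z * (t * norm z) ^ k)"
      by (rule summable_mult[OF summable_geometric])
    moreover have "norm (\<alpha> (Suc k) * z ^ Suc k) = r * (1 - t\<^sup>2) * norm z * (t * norm z) ^ k" for k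
      using t by (simp add: \<alpha>_def norm_mult norm_power pr norm_t power_mult_distrib)
    ultimately have "summable (\<lambda>k. norm (\<alpha> (Suc k) * z ^ Suc k))" by (simp only:)
    then have "summable (\<lambda>k. norm (\<alpha> k * z ^ k))"
      by (subst (asm) summable_Suc_iff)
    then have "summable (\<lambda>k. norm (a (2 ^ k) * of_nat (2 ^ k) powr (- s)))"
      unfolding pow a_pow z_def .
    moreover have "summable (\<lambda>n. norm (a (n + 1) * of_nat (n + 1) powr (- s)))
        \<longleftrightarrow> summable (\<lambda>k. norm (a (2 ^ k) * of_nat (2 ^ k) powr (- s)))"
      unfolding summable_def
      by (rule ex_cong1, rule powers_of_two_sparse(1)[where F = "\<lambda>n. norm (a n * of_nat n powr (- s))"])
         (simp add: a_zero)
    ultimately show "summable (\<lambda>n. norm (a (n + 1) * of_nat (n + 1) powr (- s)))"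
      by blast
  qed
  ultimately have "bohr_inequality G \<sigma> a" using adm by blast
  then have less: "(\<Sum>n. norm (a (n + 2)) / real (n + 2) powr \<sigma>) < infdist (a 1) (frontier (convex hull G))"
    by (simp add: bohr_inequality_def)
  have "(\<lambda>n. norm (a (n + 2)) / real (n + 2) powr \<sigma>) sums (r * (1 - t\<^sup>2) / y * (1 / (1 - t / y)))"
  proof (subst powers_of_two_sparse(2)[where F = "\<lambda>n. norm (a n) / real n powr \<sigma>"])
    have "norm (t / y) < 1" using t y by simp
    then have "(\<lambda>k. r * (1 - t\<^sup>2) / y * (t / y) ^ k) sums (r * (1 - t\<^sup>2) / y * (1 / (1 - t / y)))"
      by (rule sums_mult[OF geometric_sums])
    moreover have "r * (1 - t\<^sup>2) / y * (t / y) ^ k = norm (a (2 ^ Suc k)) / real (2 ^ Suc k) powr \<sigma>" for k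
    proof -
      have "norm (a (2 ^ Suc k)) = r * (1 - t\<^sup>2) * t ^ k"
        unfolding a_pow using t by (simp add: \<alpha>_def norm_mult norm_power pr norm_t)
      moreover have "real (2 ^ Suc k) powr \<sigma> = y ^ Suc k"
      proof -
        have "real (2 ^ Suc k) powr \<sigma> = (2 powr real (Suc k)) powr \<sigma>"
          by (simp only: powr_realpow of_nat_power of_nat_numeral zero_less_numeral)
        also have "\<dots> = y powr real (Suc k)"
          by (simp only: y_def powr_powr mult.commute)
        also have "\<dots> = y ^ Suc k"
          using y by (intro powr_realpow) simp
        finally show ?thesis .
      qed
      ultimately show ?thesis by (simp add: power_divide)
    qed
    ultimately show "(\<lambda>k. norm (a (2 ^ Suc k)) / real (2 ^ Suc k) powr \<sigma>) sums
        (r * (1 - t\<^sup>2) / y * (1 / (1 - t / y)))"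
      by (simp only:)
  qed (simp add: a_zero)
  then have "(\<Sum>n. norm (a (n + 2)) / real (n + 2) powr \<sigma>) = r * (1 - t\<^sup>2) / y * (1 / (1 - t / y))"
    by (rule sums_unique[symmetric])
  also have "\<dots> = r * (1 - t) * ((1 + t) / (y - t))"
    using y t by (simp add: divide_simps) (simp add: power2_eq_square algebra_simps)
  also have "\<dots> \<ge> r * (1 - t) * 1"
    using r t y by (intro mult_left_mono) (auto simp: field_simps)
  finally have "r * (1 - t) < infdist (a 1) (frontier (convex hull G))"
    using less by linarith
  also have "\<dots> \<le> dist (a 1) p"
    by (rule infdist_le[OF pC])
  also have "\<dots> = norm ((p - c) * of_real (1 - t))"
  proof -
    have "p - a 1 = (p - c) * of_real (1 - t)"
      using a_pow[of 0] by (simp add: \<alpha>_def algebra_simps)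
    then show ?thesis by (simp only: dist_norm norm_minus_commute[of "a 1"])
  qed
  also have "\<dots> = r * (1 - t)"
    unfolding norm_mult pr using t by (simp only: norm_of_real)
  finally show False by simp
qed

section \<open>Bounds for the Bohr abscissas\<close>

theorem corollary3p1:
  shows "(\<forall>G. is_domain G \<and> bounded G \<and> (\<exists>p\<in>frontier G. regular_point_of_convexity G p) \<longrightarrow>
            ereal (ln 3 / ln 2) \<le> bohr_abscissa G \<and> bohr_abscissa G < ereal 1.7267) \<and>
         (\<forall>G. is_domain G \<and> G \<noteq> UNIV \<and> (\<exists>p\<in>frontier G. regular_point_of_convexity G p) \<longrightarrow>
            ereal (ln 3 / ln 2) \<le> bohr_abscissa_abs G \<and> bohr_abscissa_abs G < ereal 1.7267)"
proof -
  have "ereal (ln 3 / ln 2) \<le> bohr_abscissa G \<and> ereal (ln 3 / ln 2) \<le> bohr_abscissa_abs G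
      \<and> bohr_abscissa G < ereal 1.7267 \<and> bohr_abscissa_abs G < ereal 1.7267"
    if G: "is_domain G" and p: "regular_point_of_convexity G p" for G p
  proof -
    have "open G" using G by (simp add: is_domain_def)
    moreover have "frontier (convex hull G) \<noteq> {}"
      using p unfolding regular_point_of_convexity_def point_of_convexity_def by blast
    ultimately have upper: "bohr_abscissa G \<le> ereal (12/7)" "bohr_abscissa_abs G \<le> ereal (12/7)"
      unfolding bohr_abscissa_def bohr_abscissa_abs_def
      by (auto intro!: Inf_lower bohr_inequality_12_7 exI[of _ "12/7"])
    have "ereal (12/7) < ereal 1.7267" by simp
    moreover have "ereal (ln 3 / ln 2) \<le> bohr_abscissa G" "ereal (ln 3 / ln 2) \<le> bohr_abscissa_abs G"
      unfolding bohr_abscissa_def bohr_abscissa_abs_def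
      by (auto intro!: Inf_greatest bohr_lower_bound[OF p])
    ultimately show ?thesis using upper by (meson order_le_less_trans)
  qed
  then show ?thesis by blast
qed

end
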